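(* Let $A\in\mathbb{R}^{m\times n}$, $y\in\mathbb{R}^m$, $\lambda>0$, let $\|\cdot\|$ be a norm on $\mathbb{R}^n$, and let $f=\tfrac12\|y-\cdot\|_2^2$ on $\mathbb{R}^m$ and $g=\lambda\|\cdot\|$ on $\mathbb{R}^n$. Let $P(x)=f(Ax)+g(x)$, $D(u)=-f^*(-u)-g^*(A^{\top}u)$ and $\mathrm{GAP}(x,u)=P(x)-D(u)$. For $(x,u)\in\mathrm{dom}(P)\times\mathrm{dom}(-D)$ define $$t^\star=\max\left(0,\frac{\langle Ax,\,y+u\rangle-2\lambda\|x\|}{\|Ax\|_2^2}\right)$$ (with the conventions $0/0=0$ and $1/0=+\infty$), and $$c_{\mathrm{EDPP}}=\tfrac12\bigl(y+u-t^\star Ax\bigr),\qquad r_{\mathrm{EDPP}}=\tfrac12\sqrt{\|y-u\|_2^2-\|t^\star Ax\|_2^2}.$$ Then for every $(x,u)\in\mathrm{dom}(P)\times\mathrm{dom}(-D)$: (i) $\displaystyle t^\star\in\operatorname*{arg\,min}_{t\ge 0}\sqrt{\mathrm{GAP}(tx,u)-\tfrac14\|u+\nabla f(tAx)\|_2^2}$; (ii) $\mathcal{B}(c_{\mathrm{EDPP}},r_{\mathrm{EDPP}})=\mathcal{B}_{\mathrm{RYU}}(t^\star x,u)$.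
   Context: $h^*(z^* )=\sup_z \langle z^*,z\rangle-h(z)$ denotes the convex conjugate of $h$, and $\mathrm{dom}(h)=\{z: h(z)<+\infty\}$. $\mathcal{B}(c,r)=\{v\in\mathbb{R}^m:\|v-c\|_2\le r\}$ for $r\ge 0$. If $Ax=0$, the conventions give $t^\star=0$. For a problem in which $\nabla f$ is $\alpha^{-1}$-Lipschitz and $(x,u)\in\mathrm{dom}(P)\times\mathrm{dom}(-D)$, the RYU ball is $\mathcal{B}_{\mathrm{RYU}}(x,u)=\mathcal{B}(c_{\mathrm{RYU}},r_{\mathrm{RYU}})$ with $c_{\mathrm{RYU}}=\frac12(u-\nabla f(Ax))$ and $r_{\mathrm{RYU}}=\sqrt{\frac{\mathrm{GAP}(x,u)}{\alpha}-\frac{\|u+\nabla f(Ax)\|_2^2}{4}}$; the quantity under the square root is nonnegative. Here $f=\frac12\|y-\cdot\|_2^2$ and $\alpha=1$. *)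

theory Defs
  imports "HOL-Analysis.Analysis"
begin

definition is_norm :: "('a::real_vector \<Rightarrow> real) \<Rightarrow> bool" where
  "is_norm N \<longleftrightarrow>
     (\<forall>x. 0 \<le> N x) \<and> (\<forall>x. N x = 0 \<longleftrightarrow> x = 0) \<and>
     (\<forall>a x. N (a *\<^sub>R x) = \<bar>a\<bar> * N x) \<and> (\<forall>x y. N (x + y) \<le> N x + N y)"

definition edom :: "('a \<Rightarrow> ereal) \<Rightarrow> 'a set" where
  "edom h = {z. h z < \<infinity>}"

definition conjugate :: "('a::real_inner \<Rightarrow> ereal) \<Rightarrow> 'a \<Rightarrow> ereal" where
  "conjugate h z' = (SUP z. ereal (inner z' z) - h z)"

definition grad :: "('a::real_inner \<Rightarrow> real) \<Rightarrow> 'a \<Rightarrow> 'a" where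
  "grad f z = (THE d. GDERIV f z :> d)"

text \<open>The loss \<open>f\<close> is real-valued (it is differentiable everywhere), while the
  regularizer \<open>g\<close> may take the value \<open>\<infinity>\<close>.\<close>

definition primal ::
  "(real^'m \<Rightarrow> real) \<Rightarrow> (real^'n \<Rightarrow> ereal) \<Rightarrow> real^'n^'m \<Rightarrow> real^'n \<Rightarrow> ereal" where
  "primal f g A x = ereal (f (A *v x)) + g x"

definition dual ::
  "(real^'m \<Rightarrow> real) \<Rightarrow> (real^'n \<Rightarrow> ereal) \<Rightarrow> real^'n^'m \<Rightarrow> real^'m \<Rightarrow> ereal" where
  "dual f g A u = - conjugate (\<lambda>z. ereal (f z)) (- u) - conjugate g (transpose A *v u)"

definition gap ::
  "(real^'m \<Rightarrow> real) \<Rightarrow> (real^'n \<Rightarrow> ereal) \<Rightarrow> real^'n^'m \<Rightarrow> real^'n \<Rightarrow> real^'m \<Rightarrow> ereal" where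
  "gap f g A x u = primal f g A x - dual f g A u"

text \<open>Under the real square roots the gap enters through \<open>real_of_ereal\<close>. Nothing is lost:
  on \<open>dom(P) \<times> dom(-D)\<close> the gap is finite.\<close>

lemma gap_finite:
  assumes g: "\<And>z. g z \<noteq> -\<infinity>"
    and x: "x \<in> edom (primal f g A)" and u: "u \<in> edom (\<lambda>u. - dual f g A u)"
  shows "\<bar>gap f g A x u\<bar> \<noteq> \<infinity>"
proof -
  let ?a = "conjugate (\<lambda>z. ereal (f z)) (- u)"
  let ?b = "conjugate g (transpose A *v u)"
  have gx: "g x \<noteq> \<infinity>" using x by (auto simp: edom_def primal_def)
  have "ereal (inner (- u) 0) - ereal (f 0) \<le> ?a"
    unfolding conjugate_def by (rule SUP_upper) simp
  then have a: "?a \<noteq> -\<infinity>" by auto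
  have "ereal (inner (transpose A *v u) x) - g x \<le> ?b"
    unfolding conjugate_def by (rule SUP_upper) simp
  then have b: "?b \<noteq> -\<infinity>" using gx g[of x] by (cases "g x") auto
  have "\<bar>dual f g A u\<bar> \<noteq> \<infinity>"
    using u a b unfolding edom_def dual_def by (cases ?a; cases ?b) auto
  moreover have "\<bar>primal f g A x\<bar> \<noteq> \<infinity>"
    using gx g[of x] unfolding primal_def by (cases "g x") auto
  ultimately show ?thesis
    unfolding gap_def by (cases "primal f g A x"; cases "dual f g A u") auto
qed

definition ryu_center :: "(real^'m \<Rightarrow> real) \<Rightarrow> real^'n^'m \<Rightarrow> real^'n \<Rightarrow> real^'m \<Rightarrow> real^'m" where
  "ryu_center f A x u = (1/2) *\<^sub>R (u - grad f (A *v x))"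

definition ryu_radius ::
  "real \<Rightarrow> (real^'m \<Rightarrow> real) \<Rightarrow> (real^'n \<Rightarrow> ereal) \<Rightarrow> real^'n^'m \<Rightarrow> real^'n \<Rightarrow> real^'m \<Rightarrow> real" where
  "ryu_radius \<alpha> f g A x u =
     sqrt (real_of_ereal (gap f g A x u) / \<alpha> - (norm (u + grad f (A *v x)))\<^sup>2 / 4)"

definition ryu_ball ::
  "real \<Rightarrow> (real^'m \<Rightarrow> real) \<Rightarrow> (real^'n \<Rightarrow> ereal) \<Rightarrow> real^'n^'m \<Rightarrow> real^'n \<Rightarrow> real^'m \<Rightarrow> (real^'m) set" where
  "ryu_ball \<alpha> f g A x u = cball (ryu_center f A x u) (ryu_radius \<alpha> f g A x u)"

text \<open>The division is taken in \<open>ereal\<close>, whose conventions are exactly \<open>0/0 = 0\<close> and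
  \<open>1/0 = \<infinity>\<close>. If \<open>A *v x = 0\<close> the numerator is nonpositive (for \<open>lam > 0\<close> and a norm \<open>N\<close>),
  so the maximum is always finite, with value \<open>0\<close> in this case.\<close>

definition t_star ::
  "real^'n^'m \<Rightarrow> real^'m \<Rightarrow> real \<Rightarrow> (real^'n \<Rightarrow> real) \<Rightarrow> real^'n \<Rightarrow> real^'m \<Rightarrow> real" where
  "t_star A y lam N x u =
     real_of_ereal (max 0 (ereal (inner (A *v x) (y + u) - 2 * lam * N x) /
                           ereal ((norm (A *v x))\<^sup>2)))"

lemma t_star_zero:
  assumes "A *v x = 0" "lam > 0" "is_norm N"
  shows "t_star A y lam N x u = 0"
proof -
  have "0 \<le> lam * N x" using assms by (simp add: is_norm_def)
  then show ?thesis
    using assms(1) by (cases "lam * N x = 0") (auto simp: t_star_def divide_ereal_def max_def)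
qed

definition c_EDPP ::
  "real^'n^'m \<Rightarrow> real^'m \<Rightarrow> real \<Rightarrow> (real^'n \<Rightarrow> real) \<Rightarrow> real^'n \<Rightarrow> real^'m \<Rightarrow> real^'m" where
  "c_EDPP A y lam N x u = (1/2) *\<^sub>R (y + u - t_star A y lam N x u *\<^sub>R (A *v x))"

definition r_EDPP ::
  "real^'n^'m \<Rightarrow> real^'m \<Rightarrow> real \<Rightarrow> (real^'n \<Rightarrow> real) \<Rightarrow> real^'n \<Rightarrow> real^'m \<Rightarrow> real" where
  "r_EDPP A y lam N x u =
     1/2 * sqrt ((norm (y - u))\<^sup>2 - (norm (t_star A y lam N x u *\<^sub>R (A *v x)))\<^sup>2)"

end

theory Submission
  imports Defs
begin

text \<open>On \<open>dom(-D)\<close> the conjugate of the norm vanishes, so along the ray \<open>t x\<close> the squared RYU radius is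
  the quadratic \<open>(\<parallel>y - u\<parallel>\<^sup>2 + t\<^sup>2 \<parallel>A x\<parallel>\<^sup>2 - 2 t b) / 4\<close> with
  \<open>b = \<langle>A x, y + u\<rangle> - 2 \<lambda> \<parallel>x\<parallel>\<close>, whose minimiser over \<open>t \<ge> 0\<close> is \<open>t\<^sup>\<star>\<close>. Its value there simplifies
  to the EDPP radius because \<open>t\<^sup>\<star> \<parallel>A x\<parallel>\<^sup>2 = b\<close> whenever \<open>t\<^sup>\<star> \<noteq> 0\<close>.\<close>

lemma grad_half_norm_sq: "grad (\<lambda>z::'a::real_inner. 1/2 * (norm (y - z))\<^sup>2) z = z - y"
proof -
  have D: "GDERIV (\<lambda>z. 1/2 * (norm (y - z))\<^sup>2) z :> z - y"
    unfolding gderiv_def power2_norm_eq_inner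
    by (auto intro!: derivative_eq_intros simp: inner_commute algebra_simps)
  show ?thesis
    unfolding grad_def
  proof (rule the_equality)
    show "GDERIV (\<lambda>z. 1/2 * (norm (y - z))\<^sup>2) z :> z - y" by (rule D)
  next
    \<comment> \<open>\<open>grad\<close> is a definite description, so uniqueness is due: two
      gradients induce the same functional, hence agree.\<close>
    fix d assume "GDERIV (\<lambda>z. 1/2 * (norm (y - z))\<^sup>2) z :> d"
    then have "(\<lambda>h. inner h d) = (\<lambda>h. inner h (z - y))"
      using D unfolding gderiv_def by (rule has_derivative_unique)
    then show "d = z - y" by (metis vector_eq_ldot)
  qed
qed

lemma conjugate_half_norm_sq:
  "conjugate (\<lambda>z. ereal (1/2 * (norm (y - z))\<^sup>2)) v = ereal ((norm v)\<^sup>2 / 2 + inner v y)"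
  unfolding conjugate_def
proof (rule antisym)
  show "(SUP z. ereal (inner v z) - ereal (1/2 * (norm (y - z))\<^sup>2))
        \<le> ereal ((norm v)\<^sup>2 / 2 + inner v y)"
  proof (rule SUP_least)
    fix z
    \<comment> \<open>The two sides differ by half this square, which vanishes at the maximiser
      \<open>z = y + v\<close>.\<close>
    have "0 \<le> (norm (v + y - z))\<^sup>2" by simp
    then show "ereal (inner v z) - ereal (1/2 * (norm (y - z))\<^sup>2)
        \<le> ereal ((norm v)\<^sup>2 / 2 + inner v y)"
      by (simp add: power2_norm_eq_inner algebra_simps inner_commute)
  qed
  have "ereal ((norm v)\<^sup>2 / 2 + inner v y)
      = ereal (inner v (y + v)) - ereal (1/2 * (norm (y - (y + v)))\<^sup>2)"
    by (simp add: power2_norm_eq_inner algebra_simps)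
  also have "\<dots> \<le> (SUP z. ereal (inner v z) - ereal (1/2 * (norm (y - z))\<^sup>2))"
    by (rule SUP_upper) simp
  finally show "ereal ((norm v)\<^sup>2 / 2 + inner v y)
      \<le> (SUP z. ereal (inner v z) - ereal (1/2 * (norm (y - z))\<^sup>2))" .
qed

text \<open>A positive value of \<open>inner v z - h z\<close> would grow without bound along the
  ray through \<open>z\<close>; a finite supremum is therefore the value 0 at the origin.\<close>

lemma conjugate_pos_homogeneous:
  fixes h :: "'a::real_inner \<Rightarrow> real"
  assumes hom: "\<And>t z. 0 \<le> t \<Longrightarrow> h (t *\<^sub>R z) = t * h z"
    and fin: "conjugate (\<lambda>z. ereal (h z)) v \<noteq> \<infinity>"
  shows "conjugate (\<lambda>z. ereal (h z)) v = 0"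
proof -
  let ?C = "conjugate (\<lambda>z. ereal (h z)) v"
  have up: "ereal (inner v z - h z) \<le> ?C" for z
  proof -
    have "ereal (inner v z) - ereal (h z) \<le> ?C"
      unfolding conjugate_def by (rule SUP_upper) simp
    then show ?thesis by simp
  qed
  have "h 0 = 0" using hom[of 0 0] by simp
  then have nonneg: "0 \<le> ?C" using up[of 0] by (simp add: zero_ereal_def)
  then obtain r where r: "?C = ereal r" using fin by (cases ?C) auto
  have "inner v z - h z \<le> 0" for z
  proof (rule ccontr)
    assume "\<not> inner v z - h z \<le> 0"
    then have pos: "0 < inner v z - h z" by simp
    \<comment> \<open>Scaling by this factor produces the value \<open>r + 1\<close>, above the
      supremum \<open>r\<close>.\<close>
    define t where "t = (r + 1) / (inner v z - h z)"
    have "0 \<le> r" using nonneg r by simp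
    then have "0 \<le> t" using pos by (simp add: t_def)
    then have "inner v (t *\<^sub>R z) - h (t *\<^sub>R z) = t * (inner v z - h z)"
      by (simp add: hom algebra_simps)
    also have "\<dots> = r + 1" using pos by (simp add: t_def)
    finally show False using up[of "t *\<^sub>R z"] r by simp
  qed
  then have "?C \<le> 0"
    unfolding conjugate_def by (auto intro!: SUP_least simp: zero_ereal_def)
  then show ?thesis using nonneg by (rule antisym)
qed

text \<open>Passes to real division: when \<open>A *v x = 0\<close>, its convention
  \<open>b / 0 = 0\<close> gives the same value 0.\<close>

lemma t_star_eq:
  assumes "lam > 0" "is_norm N"
  shows "t_star A y lam N x u
    = max 0 ((inner (A *v x) (y + u) - 2 * lam * N x) / (norm (A *v x))\<^sup>2)"
proof (cases "A *v x = 0")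
  case True
  then show ?thesis using t_star_zero[OF True assms] by simp
next
  case False
  then show ?thesis
    by (simp add: t_star_def zero_ereal_def flip: ereal_max)
qed

text \<open>Optimality conditions for a convex quadratic on the half-line: at the minimiser
  \<open>s\<close>, the half-derivative \<open>W * s - b\<close> is nonnegative and its product with
  \<open>s\<close> is zero.\<close>

lemma quadratic_arg_min_nonneg:
  fixes W b :: real
  assumes "0 \<le> W" "W = 0 \<Longrightarrow> b \<le> 0" "0 \<le> t"
  shows "W * (max 0 (b / W))\<^sup>2 = b * max 0 (b / W)"
    and "W * (max 0 (b / W))\<^sup>2 - 2 * b * max 0 (b / W) \<le> W * t\<^sup>2 - 2 * b * t"
proof -
  let ?s = "max 0 (b / W)"
  show eq: "W * ?s\<^sup>2 = b * ?s"
    by (cases "W = 0") (auto simp: max_def power2_eq_square)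
  have "b \<le> W * ?s"
  proof (cases "W = 0")
    case False
    then have "W * (b / W) = b" by simp
    moreover have "W * (b / W) \<le> W * ?s" using assms(1) by (intro mult_left_mono) auto
    ultimately show ?thesis by simp
  qed (use assms in simp)
  \<comment> \<open>Expansion of the quadratic around \<open>?s\<close>; the remaining term
    \<open>2 * ?s * (W * ?s - b)\<close> is zero by \<open>eq\<close>.\<close>
  then have "0 \<le> W * (t - ?s)\<^sup>2 + 2 * (t * (W * ?s - b))"
    using assms by simp
  also have "\<dots> = W * t\<^sup>2 - 2 * b * t + W * ?s\<^sup>2"
    by (simp add: power2_eq_square algebra_simps)
  finally have "0 \<le> W * t\<^sup>2 - 2 * b * t + W * ?s\<^sup>2" .
  then show "W * ?s\<^sup>2 - 2 * b * ?s \<le> W * t\<^sup>2 - 2 * b * t"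
    using eq by linarith
qed

theorem proposition4p6:
  fixes A :: "real^'n^'m" and y :: "real^'m" and lam :: real
    and N :: "real^'n \<Rightarrow> real" and f :: "real^'m \<Rightarrow> real" and g :: "real^'n \<Rightarrow> ereal"
    and x :: "real^'n" and u :: "real^'m"
  assumes lam: "lam > 0"
    and N: "is_norm N"
    and f: "f = (\<lambda>z. 1/2 * (norm (y - z))\<^sup>2)"
    and g: "g = (\<lambda>z. ereal (lam * N z))"
    and x: "x \<in> edom (primal f g A)"
    and u: "u \<in> edom (\<lambda>v. - dual f g A v)"
  shows "is_arg_min
           (\<lambda>t. sqrt (real_of_ereal (gap f g A (t *\<^sub>R x) u)
                      - 1/4 * (norm (u + grad f (t *\<^sub>R (A *v x))))\<^sup>2))
           (\<lambda>t. t \<ge> 0) (t_star A y lam N x u)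
         \<and> cball (c_EDPP A y lam N x u) (r_EDPP A y lam N x u)
           = ryu_ball 1 f g A (t_star A y lam N x u *\<^sub>R x) u"
proof -
  let ?w = "A *v x"
  let ?W = "(norm ?w)\<^sup>2"
  define b where "b = inner ?w (y + u) - 2 * lam * N x"
  define s where "s = t_star A y lam N x u"
  have s_eq: "s = max 0 (b / ?W)" unfolding s_def b_def by (rule t_star_eq[OF lam N])
  have s0: "0 \<le> s" by (simp add: s_eq)
  have b0: "b \<le> 0" if "?W = 0" using that lam N by (simp add: b_def is_norm_def)

  have conj_f: "conjugate (\<lambda>z. ereal (f z)) (- u) = ereal ((norm u)\<^sup>2 / 2 - inner u y)"
    unfolding f conjugate_half_norm_sq by simp
  \<comment> \<open>Since the conjugate of \<open>f\<close> is finite at \<open>- u\<close>,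
    finiteness of \<open>-D(u)\<close> passes to the conjugate of \<open>g\<close>.\<close>
  have "conjugate g (transpose A *v u) \<noteq> \<infinity>"
    using u by (auto simp: edom_def dual_def conj_f)
  then have conj_g: "conjugate g (transpose A *v u) = 0"
    unfolding g using N by (intro conjugate_pos_homogeneous) (auto simp: is_norm_def)

  have dual_u: "dual f g A u = ereal (inner u y - (norm u)\<^sup>2 / 2)"
    unfolding dual_def conj_f conj_g by simp
  \<comment> \<open>For \<open>t\<close> \<ge> 0 the factor \<bar>\<open>t\<close>\<bar> from the
    norm is \<open>t\<close>, so the regularizer is linear in \<open>t\<close>.\<close>
  have gap_t: "real_of_ereal (gap f g A (t *\<^sub>R x) u)
      = 1/2 * (norm (y - t *\<^sub>R ?w))\<^sup>2 + lam * (t * N x) + (norm u)\<^sup>2 / 2 - inner u y"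
    if "0 \<le> t" for t
    using that N
    unfolding gap_def dual_u primal_def
    by (simp add: matrix_vector_mult_scaleR f g is_norm_def)
  have quad: "real_of_ereal (gap f g A (t *\<^sub>R x) u) - 1/4 * (norm (u + grad f (t *\<^sub>R ?w)))\<^sup>2
      = ((norm (y - u))\<^sup>2 + (?W * t\<^sup>2 - 2 * b * t)) / 4" if "0 \<le> t" for t
    unfolding gap_t[OF that] unfolding f grad_half_norm_sq b_def
    unfolding power2_norm_eq_inner by (simp add: algebra_simps inner_commute power2_eq_square)

  have "is_arg_min
      (\<lambda>t. sqrt (real_of_ereal (gap f g A (t *\<^sub>R x) u) - 1/4 * (norm (u + grad f (t *\<^sub>R ?w)))\<^sup>2))
      (\<lambda>t. t \<ge> 0) s"
    unfolding is_arg_min_linorder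
  proof (intro conjI allI impI)
    fix t :: real assume t: "0 \<le> t"
    have "?W * s\<^sup>2 - 2 * b * s \<le> ?W * t\<^sup>2 - 2 * b * t"
      unfolding s_eq using b0 t by (intro quadratic_arg_min_nonneg(2)) auto
    then show "sqrt (real_of_ereal (gap f g A (s *\<^sub>R x) u) - 1/4 * (norm (u + grad f (s *\<^sub>R ?w)))\<^sup>2)
        \<le> sqrt (real_of_ereal (gap f g A (t *\<^sub>R x) u) - 1/4 * (norm (u + grad f (t *\<^sub>R ?w)))\<^sup>2)"
      \<comment> \<open>The real \<open>sqrt\<close> is increasing on the whole line, so comparing
        radicands suffices.\<close>
      unfolding quad[OF s0] quad[OF t] by simp
  qed (rule s0)
  moreover have "c_EDPP A y lam N x u = ryu_center f A (s *\<^sub>R x) u"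
    unfolding c_EDPP_def ryu_center_def f grad_half_norm_sq
    by (simp add: s_def matrix_vector_mult_scaleR algebra_simps)
  moreover have "r_EDPP A y lam N x u = ryu_radius 1 f g A (s *\<^sub>R x) u"
  proof -
    \<comment> \<open>This turns \<open>?W * s\<^sup>2 - 2 * b * s\<close> into
      \<open>- ?W * s\<^sup>2\<close>, the subtracted term of the EDPP radius.\<close>
    have "?W * s\<^sup>2 = b * s"
      unfolding s_eq using b0 by (intro quadratic_arg_min_nonneg(1)) auto
    then have "ryu_radius 1 f g A (s *\<^sub>R x) u = sqrt (((norm (y - u))\<^sup>2 - (norm (s *\<^sub>R ?w))\<^sup>2) / 4)"
      using quad[OF s0]
      by (simp add: ryu_radius_def matrix_vector_mult_scaleR power_mult_distrib algebra_simps)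
    then show ?thesis
      by (simp add: r_EDPP_def real_sqrt_divide flip: s_def)
  qed
  ultimately show ?thesis by (simp add: ryu_ball_def flip: s_def)
qed

end
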